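(* Let $\mathcal X_0\in\mathrm{Gr}(n,k)$ satisfy $\mathrm{dist}(\mathcal X_0,\mathcal V_\alpha)\le\frac\pi4$ and suppose $\gamma>0$. Then the iterates of Riemannian steepest descent with step size $\eta=\frac1\gamma$, i.e. $\mathcal X_{t+1}=\mathrm{Exp}_{\mathcal X_t}\bigl(-\tfrac1\gamma\,\mathrm{grad}f(\mathcal X_t)\bigr)$, satisfy for all $t\ge0$ $$f(\mathcal X_t)-f^*\le\frac{f(\mathcal X_0)-f^*+\frac\gamma2\,\mathrm{dist}^2(\mathcal X_0,\mathcal V_\alpha)}{0.4\,t+1}$$ (and hence $f(\mathcal X_t)-f^*=\mathcal O(1/t)$).
   Context: Let $1\le k\le n-1$ and let $A\in\mathbb R^{n\times n}$ be symmetric positive semidefinite with eigenvalues $\lambda_1\ge\cdots\ge\lambda_n$ (with multiplicity) and orthonormal eigenvectors $v_1,\dots,v_n$, $Av_i=\lambda_iv_i$. Put $\gamma=2(\lambda_1-\lambda_n)$ and $\mathcal V_\alpha=\mathrm{span}(v_1,\dots,v_k)$. No assumption is made on the eigengap: if $\lambda_k=\lambda_{k+1}$, $\mathcal V_\alpha$ is any fixed subspace spanned by $k$ leading eigenvectors. $\mathrm{Gr}(n,k)$ is the Grassmann manifold of $k$-dimensional subspaces of $\mathbb R^n$; a subspace $\mathcal X=\mathrm{span}(X)$ is always represented by $X\in\mathbb R^{n\times k}$ with $X^TX=I_k$. Tangent vectors at $\mathcal X$ (for a given representative $X$) are the $G\in\mathbb R^{n\times k}$ with $X^TG=0$; the Riemannian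 metric is $\langle G_1,G_2\rangle=\mathrm{Tr}(G_1^TG_2)$. Exponential map: $\mathrm{Exp}_{\mathcal X}(G)=\mathrm{span}(XV\cos(\Sigma)+U\sin(\Sigma))$, where $G=U\Sigma V^T$ is a compact SVD with $\Sigma,V\in\mathbb R^{k\times k}$. The principal angles $0\le\theta_1\le\cdots\le\theta_k\le\pi/2$ between $\mathcal X=\mathrm{span}(X)$ and $\mathcal Y=\mathrm{span}(Y)$ are such that $\cos\theta_1,\dots,\cos\theta_k$ are the singular values of $Y^TX$; the Riemannian distance is $\mathrm{dist}(\mathcal X,\mathcal Y)=\sqrt{\theta_1^2+\cdots+\theta_k^2}$. The objective is $f:\mathrm{Gr}(n,k)\to\mathbb R$, $f(\mathcal X)=-\mathrm{Tr}(X^TAX)$, with Riemannian gradient $\mathrm{grad}f(\mathcal X)=-2(I-XX^T)AX$ and global minimum $f^*=-(\lambda_1+\cdots+\lambda_k)$. *)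

theory Defs
  imports "HOL-Analysis.Analysis" "HOL-Library.Landau_Symbols"
begin

text \<open>A matrix with \<open>n\<close> rows and \<open>k\<close> columns has type \<open>real^'k^'n\<close>; points of \<open>Gr(n,k)\<close> are
  \<open>k\<close>-dimensional subspaces of \<open>real^'n\<close> with \<open>k = CARD('k)\<close>, always accessed through a matrix
  with orthonormal columns spanning them.\<close>

definition represents :: "real^'k^'n \<Rightarrow> (real^'n) set \<Rightarrow> bool" where
  "represents X S \<longleftrightarrow> transpose X ** X = mat 1 \<and> span (columns X) = S"

definition diag_mat :: "real^'k \<Rightarrow> real^'k^'k" where
  "diag_mat d = (\<chi> i j. if i = j then d $ i else 0)"

text \<open>The compact form used here always has \<open>k\<close> columns in \<open>U\<close>, zero singular values being
  allowed. The singular values are not ordered.\<close>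

definition compact_svd ::
  "real^'k^'n \<Rightarrow> real^'k^'n \<Rightarrow> real^'k \<Rightarrow> real^'k^'k \<Rightarrow> bool" where
  "compact_svd G U \<sigma> V \<longleftrightarrow>
     transpose U ** U = mat 1 \<and> orthogonal_matrix V \<and> (\<forall>i. 0 \<le> \<sigma> $ i) \<and>
     G = U ** diag_mat \<sigma> ** transpose V"

text \<open>For \<open>G\<close> tangent at \<open>span X\<close> the resulting subspace does not depend on the chosen
  decomposition.\<close>

definition gr_exp :: "real^'k^'n \<Rightarrow> real^'k^'n \<Rightarrow> (real^'n) set" where
  "gr_exp X G =
     (let (U, \<sigma>, V) = (SOME (U, \<sigma>, V). compact_svd G U \<sigma> V)
      in span (columns (X ** V ** diag_mat (\<chi> i. cos (\<sigma> $ i)) + U ** diag_mat (\<chi> i. sin (\<sigma> $ i)))))"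

text \<open>The principal angles form a family indexed by \<open>'k\<close>, determined up to permutation;
  the distance is symmetric in them.\<close>

definition principal_angles :: "real^'k^'n \<Rightarrow> real^'k^'n \<Rightarrow> real^'k \<Rightarrow> bool" where
  "principal_angles X Y \<theta> \<longleftrightarrow>
     (\<forall>i. 0 \<le> \<theta> $ i \<and> \<theta> $ i \<le> pi / 2) \<and>
     (\<exists>P Q. compact_svd (transpose Y ** X) P (\<chi> i. cos (\<theta> $ i)) Q)"

definition gr_dist :: "real^'k^'n \<Rightarrow> real^'k^'n \<Rightarrow> real" where
  "gr_dist X Y = (let \<theta> = (SOME \<theta>. principal_angles X Y \<theta>) in sqrt (\<Sum>i\<in>UNIV. (\<theta> $ i)\<^sup>2))"

definition gr_obj :: "real^'n^'n \<Rightarrow> real^'k^'n \<Rightarrow> real" where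
  "gr_obj A X = - trace (transpose X ** A ** X)"

definition gr_grad :: "real^'n^'n \<Rightarrow> real^'k^'n \<Rightarrow> real^'k^'n" where
  "gr_grad A X = (-2) *\<^sub>R ((mat 1 - X ** transpose X) ** A ** X)"

end

theory Submission
  imports Defs
begin

text \<open>
  The proof runs the classical argument for gradient descent with the Riemannian distance to the
  target replaced by the chordal distance \<open>P = \<Sum> sin\<^sup>2 \<theta>\<^sub>i = k - \<bar>Y\<^sup>T X\<bar>\<^sup>2\<close> (\<open>chordal_sq\<close>), where \<open>\<theta>\<^sub>i\<close> are the
  principal angles. Since \<open>sin\<^sup>2 \<theta> \<le> \<theta>\<^sup>2\<close>, the initial value of \<open>P\<close> is at most the squared Riemannian
  distance. The gain is that \<open>P\<close> is, up to the constant \<open>k\<close>, the same kind of function as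
  the objective, with the projection \<open>Y Y\<^sup>T\<close> in place of \<open>A\<close>. No comparison theorem for
  curved spaces is needed: one second-order bound along the exponential map (\<open>gr_obj_exp_le\<close>) serves both
  functions. Let \<open>m\<close> be the gap between the objective and its minimum and \<open>g\<close> the gradient. A step of
  length \<open>1 / \<gamma>\<close>, with primes for the values after it, gives
  \<open>m' \<le> m - \<bar>g\<bar>\<^sup>2 / (2 \<gamma>)\<close> and
  \<open>(\<gamma> / 2) P' \<le> (\<gamma> / 2) P - (grad P \<bullet> g) / 2 + \<bar>g\<bar>\<^sup>2 / (2 \<gamma>)\<close>.

  The convexity ingredient is \<open>grad P \<bullet> g \<ge> 4 (1 - P) m\<close> (\<open>grad_inner_ge\<close>). For \<open>k = 1\<close> it is an equality,
  with \<open>1 - P = cos\<^sup>2 \<theta>\<close>; in general it follows by comparing coefficients in the eigenbasis. Adding the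
  three inequalities, the terms in \<open>\<bar>g\<bar>\<^sup>2\<close> cancel and the potential \<open>m + (\<gamma> / 2) P\<close> drops by at least
  \<open>2 (1 - P) m\<close> in each step.

  It remains to keep \<open>P\<close> below \<open>0.8\<close>, for then the drop is at least \<open>0.4 m\<close>, and summing over \<open>t\<close> steps,
  with \<open>m\<close> decreasing, gives the rate. Initially \<open>P \<le> \<pi>\<^sup>2 / 16 < 0.62\<close>, and \<open>m \<le> (\<gamma> / 2) P\<close> at every
  point (\<open>gap_le_chordal\<close>); a short computation with the potential (\<open>potential_sequence_bound\<close>)
  then propagates \<open>P \<le> 0.8\<close> to all times.

  Both the exponential map and the distance are defined by choosing a decomposition, so the
  argument rests on the existence of singular value decompositions (\<open>compact_svd_exists\<close>).
\<close>

section \<open>Real matrices and their Frobenius inner product\<close>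

lemma matrix_diff_ldistrib: "(A::real^'m^'n) ** (B - C) = A ** B - A ** C"
  by (simp add: vec_eq_iff matrix_matrix_mult_def algebra_simps sum_subtractf)

lemma matrix_diff_rdistrib: "((A::real^'m^'n) - B) ** C = A ** C - B ** C"
  by (simp add: vec_eq_iff matrix_matrix_mult_def algebra_simps sum_subtractf)

lemma transpose_diff: "transpose (A - B) = transpose A - transpose (B::real^'m^'n)"
  by (simp add: vec_eq_iff transpose_def)

lemma column_matrix_mult: "column i ((A::real^'m^'n) ** B) = A *v column i B"
  by (simp add: matrix_vector_mult_basis[symmetric] matrix_vector_mul_assoc)

lemma column_mult_diag_mat: "column i ((A::real^'k^'n) ** diag_mat d) = d $ i *\<^sub>R column i A"
  by (simp add: vec_eq_iff column_def matrix_matrix_mult_def diag_mat_def if_distrib cong: if_cong)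

lemma column_add: "column i (A + B) = column i A + column i (B::real^'k^'n)"
  by (simp add: vec_eq_iff column_def)

lemma orthonormal_columns_iff:
  fixes A :: "real^'k^'n"
  shows "transpose A ** A = mat 1 \<longleftrightarrow>
    (\<forall>i j. column i A \<bullet> column j A = (if i = j then 1 else 0))"
  by (simp add: matrix_mult_transpose_dot_column mat_def vec_eq_iff)

lemma transpose_mult_component:
  fixes A :: "real^'k^'n" and B :: "real^'m^'n"
  shows "(transpose A ** B) $ i $ j = column i A \<bullet> column j B"
  by (simp add: matrix_matrix_mult_def transpose_def column_def inner_vec_def)

lemma inner_matrix_columns:
  fixes A B :: "real^'k^'n"
  shows "A \<bullet> B = (\<Sum>j\<in>UNIV. column j A \<bullet> column j B)"
  by (simp add: inner_vec_def column_def) (rule sum.swap)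

lemma inner_matrix_trace:
  fixes A B :: "real^'k^'n"
  shows "A \<bullet> B = trace (transpose A ** B)"
  by (simp add: trace_def transpose_mult_component inner_matrix_columns)

lemma inner_mult_left:
  fixes A :: "real^'k^'n" and B :: "real^'m^'k" and C :: "real^'m^'n"
  shows "(A ** B) \<bullet> C = B \<bullet> (transpose A ** C)"
  by (simp add: inner_matrix_trace matrix_transpose_mul matrix_mul_assoc)

lemma inner_mult_orthogonal:
  fixes A B :: "real^'k^'n" and V :: "real^'k^'k"
  assumes "orthogonal_matrix V"
  shows "(A ** V) \<bullet> (B ** V) = A \<bullet> B"
proof -
  have "(A ** V) \<bullet> (B ** V) = trace ((transpose V ** (transpose A ** B)) ** V)"
    by (simp add: inner_matrix_trace matrix_transpose_mul matrix_mul_assoc)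
  also have "\<dots> = trace (V ** transpose V ** (transpose A ** B))"
    by (subst trace_mul_sym) (simp add: matrix_mul_assoc)
  finally show ?thesis
    using assms by (simp add: orthogonal_matrix_def inner_matrix_trace)
qed

lemma symmetric_inner_swap:
  fixes B :: "real^'n^'n"
  assumes "transpose B = B"
  shows "(B *v x) \<bullet> y = x \<bullet> (B *v y)"
  using dot_lmul_matrix[of x B y] assms by (metis transpose_matrix_vector)

lemma norm_matrix_vector_mult_le:
  fixes A :: "real^'k^'n"
  shows "(norm (A *v x))\<^sup>2 \<le> (norm A)\<^sup>2 * (norm x)\<^sup>2"
proof -
  have "(norm (A *v x))\<^sup>2 = (\<Sum>i\<in>UNIV. (A $ i \<bullet> x)\<^sup>2)"
    by (simp only: power2_norm_eq_inner inner_vec_def[of "A *v x"])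
       (simp add: matrix_vector_mul_component power2_eq_square)
  also have "\<dots> \<le> (\<Sum>i\<in>UNIV. (A $ i \<bullet> A $ i) * (x \<bullet> x))"
    by (intro sum_mono Cauchy_Schwarz_ineq)
  also have "\<dots> = (norm A)\<^sup>2 * (norm x)\<^sup>2"
    by (simp add: power2_norm_eq_inner inner_vec_def[of A] sum_distrib_right)
  finally show ?thesis .
qed

text \<open>Basis invariance of the trace. The basis is indexed by an arbitrary finite set, so that the
  eigenvectors can keep their numbering by natural numbers.\<close>

lemma trace_orthonormal_basis:
  fixes M :: "real^'n^'n" and v :: "'i \<Rightarrow> real^'n"
  assumes "finite I" "card I = CARD('n)"
    and orth: "\<And>i j. i \<in> I \<Longrightarrow> j \<in> I \<Longrightarrow> v i \<bullet> v j = (if i = j then 1 else 0)"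
  shows "trace M = (\<Sum>i\<in>I. v i \<bullet> (M *v v i))"
proof -
  obtain b where b: "bij_betw b (UNIV::'n set) I"
    using assms(1,2) by (metis finite_class.finite_UNIV finite_same_card_bij)
  define Q :: "real^'n^'n" where "Q = (\<chi> i j. v (b j) $ i)"
  have col: "column j Q = v (b j)" for j
    by (simp add: Q_def column_def vec_eq_iff)
  have "transpose Q ** Q = mat 1"
    using b orth by (auto simp: orthonormal_columns_iff col bij_betw_def inj_on_def)
  then have Q: "orthogonal_matrix Q" by (simp add: orthogonal_matrix)
  have "trace M = trace (M ** (Q ** transpose Q))"
    using Q by (simp add: orthogonal_matrix_def)
  also have "\<dots> = trace (transpose Q ** (M ** Q))"
    using trace_mul_sym[of "M ** Q" "transpose Q"] by (simp add: matrix_mul_assoc)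
  also have "\<dots> = (\<Sum>j\<in>UNIV. v (b j) \<bullet> (M *v v (b j)))"
    by (simp add: trace_def transpose_mult_component column_matrix_mult col)
  also have "\<dots> = (\<Sum>i\<in>I. v i \<bullet> (M *v v i))"
    by (rule sum.reindex_bij_betw[OF b])
  finally show ?thesis .
qed

text \<open>Parseval, as the trace of the rank-one matrix \<open>y x\<^sup>T\<close>.\<close>

lemma inner_orthonormal_basis:
  fixes x y :: "real^'n" and v :: "'i \<Rightarrow> real^'n"
  assumes "finite I" "card I = CARD('n)"
    and orth: "\<And>i j. i \<in> I \<Longrightarrow> j \<in> I \<Longrightarrow> v i \<bullet> v j = (if i = j then 1 else 0)"
  shows "x \<bullet> y = (\<Sum>i\<in>I. (v i \<bullet> x) * (v i \<bullet> y))"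
proof -
  define M :: "real^'n^'n" where "M = (\<chi> i j. y $ i * x $ j)"
  have "M *v z = (x \<bullet> z) *\<^sub>R y" for z
    by (simp add: M_def vec_eq_iff matrix_vector_mult_def inner_vec_def sum_distrib_left mult_ac)
  moreover have "trace M = x \<bullet> y"
    by (simp add: trace_def M_def inner_vec_def mult.commute)
  ultimately show ?thesis
    using trace_orthonormal_basis[OF assms, of M] by (simp add: inner_commute)
qed

section \<open>Existence of compact singular value decompositions\<close>

text \<open>The maximum is at least the norm of \<open>w\<close>, attained at \<open>w / norm w\<close>, so \<open>x\<close> is in the
  equality case of the Cauchy--Schwarz inequality.\<close>

lemma unit_vector_maximizing:
  fixes w :: "'a::euclidean_space"
  assumes "subspace S" "w \<in> S" "x \<in> S" "norm x = 1"
    and max: "\<And>z. z \<in> S \<Longrightarrow> norm z = 1 \<Longrightarrow> w \<bullet> z \<le> w \<bullet> x"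
  shows "w = (w \<bullet> x) *\<^sub>R x"
proof (cases "w = 0")
  case False
  have "w \<bullet> (inverse (norm w) *\<^sub>R w) \<le> w \<bullet> x"
    using False assms by (intro max) (auto simp: subspace_scale)
  then have "norm w \<le> w \<bullet> x"
    using False by (simp add: power2_norm_eq_inner[symmetric] power2_eq_square mult.assoc[symmetric])
  then have "(norm w)\<^sup>2 \<le> (w \<bullet> x)\<^sup>2"
    by (simp add: power_mono)
  moreover have "(norm (w - (w \<bullet> x) *\<^sub>R x))\<^sup>2 = (norm w)\<^sup>2 - (w \<bullet> x)\<^sup>2"
    unfolding power2_norm_eq_inner using assms(4)
    by (simp add: inner_diff inner_commute norm_eq_1 power2_eq_square)
  ultimately have "(norm (w - (w \<bullet> x) *\<^sub>R x))\<^sup>2 \<le> 0" by simp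
  then show ?thesis by simp
qed simp

lemma unit_vector_orthogonal_to:
  fixes x :: "'i \<Rightarrow> 'a::euclidean_space"
  assumes "finite J" "card J < DIM('a)"
  shows "\<exists>z. norm z = 1 \<and> (\<forall>j\<in>J. x j \<bullet> z = 0)"
proof -
  have "dim (x ` J) \<le> card (x ` J)"
    using assms(1) by (intro dim_le_card) (auto simp: span_base)
  also have "\<dots> < DIM('a)"
    using assms card_image_le[of J x] by linarith
  finally obtain z where z: "z \<noteq> 0" and "\<And>y. y \<in> span (x ` J) \<Longrightarrow> orthogonal z y"
    using orthogonal_to_subspace_exists by blast
  then have "x j \<bullet> z = 0" if "j \<in> J" for j
    using that by (metis imageI span_base orthogonal_def inner_commute)
  with z show ?thesis
    by (intro exI[of _ "inverse (norm z) *\<^sub>R z"]) auto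
qed

text \<open>One pair of singular vectors is added at a time: on the orthogonal complements \<open>S\<close> and \<open>T\<close> of
  the vectors found so far, which \<open>G\<close> and its transpose map into each other, the new pair
  maximizes the bilinear form \<open>u \<bullet> (G *v x)\<close> over unit vectors. With one vector fixed the other
  maximizes a linear functional, so \<open>unit_vector_maximizing\<close> yields both singular vector
  equations. The same holds when the maximum is zero, and the left vectors come out as a
  full orthonormal family because \<open>k \<le> n\<close> leaves room in \<open>T\<close>.\<close>

lemma singular_vectors_exist:
  fixes G :: "real^'k^'n" and J :: "'k set"
  assumes "CARD('k) \<le> CARD('n)"
  shows "\<exists>(x :: 'k \<Rightarrow> real^'k) (u :: 'k \<Rightarrow> real^'n) s.
    (\<forall>i\<in>J. \<forall>j\<in>J. x i \<bullet> x j = (if i = j then 1 else 0)) \<and>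
    (\<forall>i\<in>J. \<forall>j\<in>J. u i \<bullet> u j = (if i = j then 1 else 0)) \<and>
    (\<forall>j\<in>J. 0 \<le> s j \<and> G *v x j = s j *\<^sub>R u j \<and> u j v* G = s j *\<^sub>R x j)"
proof -
  have "finite J" by simp
  then show ?thesis
  proof induction
    case (insert m J)
    then obtain x :: "'k \<Rightarrow> real^'k" and u :: "'k \<Rightarrow> real^'n" and s where
      x: "\<forall>i\<in>J. \<forall>j\<in>J. x i \<bullet> x j = (if i = j then 1 else 0)" and
      u: "\<forall>i\<in>J. \<forall>j\<in>J. u i \<bullet> u j = (if i = j then 1 else 0)" and
      s: "\<forall>j\<in>J. 0 \<le> s j \<and> G *v x j = s j *\<^sub>R u j \<and> u j v* G = s j *\<^sub>R x j"
      by blast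
    define S where "S = {z. \<forall>j\<in>J. x j \<bullet> z = 0}"
    define T where "T = {z. \<forall>j\<in>J. u j \<bullet> z = 0}"
    have sub: "subspace S" "subspace T"
      by (auto simp: S_def T_def subspace_def inner_right_distrib)
    have ST: "G *v z \<in> T" if "z \<in> S" for z
      using that s by (auto simp: S_def T_def dot_lmul_matrix[symmetric])
    have TS: "z v* G \<in> S" if "z \<in> T" for z
      using that s by (auto simp: S_def T_def dot_lmul_matrix inner_commute[of "_" "z v* G"] inner_commute[of z])
    have card: "card J < CARD('k)"
      using insert by (metis finite_class.finite_UNIV iso_tuple_UNIV_I psubsetI psubset_card_mono subset_UNIV)
    obtain x0 where x0: "norm x0 = 1" "x0 \<in> S"
      using unit_vector_orthogonal_to[of J x] card by (auto simp: S_def)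
    obtain u0 where u0: "norm u0 = 1" "u0 \<in> T"
      using unit_vector_orthogonal_to[of J u] card assms by (auto simp: T_def)
    \<comment> \<open>The domain of the bilinear form; the complements are nonzero since \<open>card J < k \<le> n\<close>.\<close>
    let ?K = "(sphere 0 1 \<inter> S) \<times> (sphere 0 1 \<inter> T)"
    have "compact ?K"
      using sub by (intro compact_Times compact_Int_closed closed_subspace) auto
    moreover have "?K \<noteq> {}" using x0 u0 by auto
    moreover have "continuous_on ?K (\<lambda>p. snd p \<bullet> (G *v fst p))"
      by (intro continuous_intros linear_continuous_on_compose[OF continuous_on_fst]) auto
    ultimately obtain p where p: "p \<in> ?K" and "\<forall>q\<in>?K. snd q \<bullet> (G *v fst q) \<le> snd p \<bullet> (G *v fst p)"
      using continuous_attains_sup[of ?K] by blast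
    moreover define xm um where "xm = fst p" and "um = snd p"
    ultimately have xm: "norm xm = 1" "xm \<in> S" and um: "norm um = 1" "um \<in> T"
      and max: "\<And>y z. y \<in> S \<Longrightarrow> norm y = 1 \<Longrightarrow> z \<in> T \<Longrightarrow> norm z = 1
        \<Longrightarrow> z \<bullet> (G *v y) \<le> um \<bullet> (G *v xm)"
      by auto
    define sm where "sm = um \<bullet> (G *v xm)"
    have "(um v* G) \<bullet> z \<le> (um v* G) \<bullet> xm" if "z \<in> S" "norm z = 1" for z
      using max[OF that um(2,1)] by (simp add: dot_lmul_matrix)
    from unit_vector_maximizing[OF sub(1) TS[OF um(2)] xm(2,1) this]
    have um': "um v* G = sm *\<^sub>R xm" by (simp add: sm_def dot_lmul_matrix)
    have "(G *v xm) \<bullet> z \<le> (G *v xm) \<bullet> um" if "z \<in> T" "norm z = 1" for z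
      using max[OF xm(2,1) that] by (simp add: inner_commute)
    from unit_vector_maximizing[OF sub(2) ST[OF xm(2)] um(2,1) this]
    have xm': "G *v xm = sm *\<^sub>R um" by (simp add: sm_def inner_commute)
    \<comment> \<open>Replacing \<open>um\<close> by \<open>- um\<close> would otherwise increase the maximum.\<close>
    have "sm \<ge> 0"
      using max[of xm "- um"] xm um sub(2) by (simp add: sm_def subspace_neg)
    then show ?case
      using insert.hyps x u s xm um xm' um'
      by (intro exI[of _ "x(m := xm)"] exI[of _ "u(m := um)"] exI[of _ "s(m := sm)"])
         (auto simp: S_def T_def norm_eq_1 inner_commute)
  qed auto
qed

lemma compact_svd_exists:
  fixes G :: "real^'k^'n"
  assumes "CARD('k) \<le> CARD('n)"
  shows "\<exists>U \<sigma> V. compact_svd G U \<sigma> V"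
proof -
  obtain x :: "'k \<Rightarrow> real^'k" and u :: "'k \<Rightarrow> real^'n" and s where
    x: "\<And>i j. x i \<bullet> x j = (if i = j then 1 else 0)" and
    u: "\<And>i j. u i \<bullet> u j = (if i = j then 1 else 0)" and
    s: "\<And>j. 0 \<le> s j" "\<And>j. G *v x j = s j *\<^sub>R u j"
    using singular_vectors_exist[OF assms, of UNIV G] by blast
  define U :: "real^'k^'n" where "U = (\<chi> i j. u j $ i)"
  define V :: "real^'k^'k" where "V = (\<chi> i j. x j $ i)"
  have col: "column j U = u j" "column j V = x j" for j
    by (simp_all add: U_def V_def column_def vec_eq_iff)
  have V: "orthogonal_matrix V"
    by (simp add: orthogonal_matrix orthonormal_columns_iff col x)
  have "column j (G ** V) = column j (U ** diag_mat (\<chi> i. s i))" for j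
    by (simp only: column_mult_diag_mat column_matrix_mult[of j G] col s vec_lambda_beta)
  then have "G ** V = U ** diag_mat (\<chi> i. s i)"
    by (simp add: vec_eq_iff column_def)
  then have "G ** (V ** transpose V) = U ** diag_mat (\<chi> i. s i) ** transpose V"
    by (simp add: matrix_mul_assoc)
  with V have "G = U ** diag_mat (\<chi> i. s i) ** transpose V"
    by (simp add: orthogonal_matrix_def)
  with V s(1) have "compact_svd G U (\<chi> i. s i) V"
    by (simp add: compact_svd_def orthonormal_columns_iff col u)
  then show ?thesis by blast
qed

lemma compact_svd_mult:
  assumes "compact_svd G U \<sigma> V"
  shows "G ** V = U ** diag_mat \<sigma>"
proof -
  have "G ** V = U ** diag_mat \<sigma> ** (transpose V ** V)"
    using assms by (simp add: compact_svd_def matrix_mul_assoc)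
  also have "transpose V ** V = mat 1"
    using assms by (simp add: compact_svd_def orthogonal_matrix_def)
  finally show ?thesis by simp
qed

lemma norm_compact_svd:
  assumes "compact_svd G U \<sigma> V"
  shows "(norm G)\<^sup>2 = (\<Sum>i\<in>UNIV. (\<sigma> $ i)\<^sup>2)"
proof -
  have "(norm G)\<^sup>2 = (U ** diag_mat \<sigma>) \<bullet> (U ** diag_mat \<sigma>)"
    using inner_mult_orthogonal[of V G G] assms
    by (simp add: power2_norm_eq_inner compact_svd_mult[OF assms] compact_svd_def[of G])
  also have "\<dots> = (\<Sum>i\<in>UNIV. (\<sigma> $ i)\<^sup>2)"
    using assms by (simp add: inner_matrix_columns column_mult_diag_mat compact_svd_def
        orthonormal_columns_iff power2_eq_square)
  finally show ?thesis .
qed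

section \<open>Orthogonal projections onto column spaces\<close>

text \<open>Points of the Grassmannian are handled through this projection: by
  \<open>col_proj_eq_if_span_eq\<close> below it depends only on the subspace, and not on the
  representative.\<close>

definition col_proj :: "real^'k^'n \<Rightarrow> real^'n^'n" where
  "col_proj X = X ** transpose X"

lemma transpose_col_proj [simp]: "transpose (col_proj X) = col_proj X"
  by (simp add: col_proj_def matrix_transpose_mul)

lemma col_proj_inner: "(col_proj X *v x) \<bullet> y = x \<bullet> (col_proj X *v y)"
  by (simp add: symmetric_inner_swap)

lemma col_proj_idem_mult:
  assumes "transpose X ** X = mat 1"
  shows "col_proj X ** col_proj X = col_proj X"
proof -
  have "col_proj X ** col_proj X = X ** (transpose X ** X) ** transpose X"
    by (simp add: col_proj_def matrix_mul_assoc)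
  then show ?thesis by (simp add: assms col_proj_def)
qed

lemma col_proj_idem:
  assumes "transpose X ** X = mat 1"
  shows "col_proj X *v (col_proj X *v x) = col_proj X *v x"
  by (simp add: matrix_vector_mul_assoc col_proj_idem_mult[OF assms])

lemma col_proj_fixes_span:
  assumes "transpose X ** X = mat 1" "x \<in> span (columns X)"
  shows "col_proj X *v x = x"
proof (rule real_vector.linear_eq_on_span[where f = "\<lambda>x. col_proj X *v x" and B = "columns X"])
  fix y assume "y \<in> columns X"
  then obtain j where y: "y = column j X" by (auto simp: columns_def)
  have "col_proj X *v (X *v axis j 1) = (X ** (transpose X ** X)) *v axis j 1"
    by (simp only: col_proj_def matrix_vector_mul_assoc matrix_mul_assoc)
  then show "col_proj X *v y = y"
    using assms(1) by (simp add: y matrix_vector_mult_basis)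
qed (use assms in \<open>auto intro: linear_ident\<close>)

lemma col_proj_in_span: "col_proj X *v x \<in> span (columns X)"
  by (metis col_proj_def matrix_vector_mul_assoc matrix_vector_mult_in_columnspace)

lemma col_proj_norm:
  assumes "transpose X ** X = mat 1"
  shows "x \<bullet> (col_proj X *v x) = (norm (col_proj X *v x))\<^sup>2"
  by (simp add: power2_norm_eq_inner col_proj_inner col_proj_idem[OF assms])

lemma col_proj_Pythagoras:
  assumes "transpose X ** X = mat 1"
  shows "(norm (x - col_proj X *v x))\<^sup>2 = (norm x)\<^sup>2 - (norm (col_proj X *v x))\<^sup>2"
  using col_proj_norm[OF assms, of x]
  by (simp add: power2_norm_eq_inner[of "x - _"] inner_diff inner_commute)
     (simp add: power2_norm_eq_inner)

lemma norm_transpose_mult_le: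
  fixes Y :: "real^'k^'n"
  assumes "transpose Y ** Y = mat 1"
  shows "norm (transpose Y *v z) \<le> norm z"
proof -
  have "(norm (transpose Y *v z))\<^sup>2 = (norm (col_proj Y *v z))\<^sup>2"
  proof -
    have "(transpose Y *v z) \<bullet> (transpose Y *v z) = z \<bullet> (col_proj Y *v z)"
      by (simp add: dot_lmul_matrix col_proj_def matrix_vector_mul_assoc[symmetric])
    then show ?thesis by (simp only: power2_norm_eq_inner[of "transpose Y *v z"] col_proj_norm[OF assms])
  qed
  also have "\<dots> \<le> (norm z)\<^sup>2"
    using col_proj_Pythagoras[OF assms, of z] zero_le_power2[of "norm (z - col_proj Y *v z)"] by linarith
  finally show ?thesis by (simp add: power_mono_iff)
qed

text \<open>Each projection fixes the range of the other, and both are symmetric.\<close>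

lemma col_proj_eq_if_span_eq:
  assumes "transpose X ** X = mat 1" "transpose W ** W = mat 1"
    and "span (columns X) = span (columns W)"
  shows "col_proj X = col_proj W"
proof -
  have *: "(col_proj X *v x) \<bullet> z = (col_proj W *v x) \<bullet> z" for x z
  proof -
    have "(col_proj X *v x) \<bullet> z = (col_proj W *v (col_proj X *v x)) \<bullet> z"
      by (metis assms(2,3) col_proj_fixes_span col_proj_in_span)
    also have "\<dots> = x \<bullet> (col_proj X *v (col_proj W *v z))"
      by (simp add: col_proj_inner)
    also have "\<dots> = (col_proj W *v x) \<bullet> z"
      by (metis assms(1,3) col_proj_fixes_span col_proj_in_span col_proj_inner)
    finally show ?thesis .
  qed
  have "col_proj X *v x = col_proj W *v x" for x
    by (rule vector_eq_rdot[THEN iffD1]) (use * in blast)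
  then show ?thesis by (simp add: matrix_eq)
qed

lemma trace_col_proj:
  fixes X :: "real^'k^'n"
  assumes "transpose X ** X = mat 1"
  shows "trace (col_proj X) = real CARD('k)"
  using trace_mul_sym[of X "transpose X"] by (simp add: col_proj_def assms trace_I)

section \<open>Quadratic upper bounds along the exponential map\<close>

lemma gr_obj_col_proj: "gr_obj B X = - trace (B ** col_proj X)"
proof -
  have "trace (transpose X ** B ** X) = trace (B ** X ** transpose X)"
    using trace_mul_sym[of "transpose X" "B ** X"] by (simp add: matrix_mul_assoc)
  then show ?thesis by (simp add: gr_obj_def col_proj_def matrix_mul_assoc)
qed

lemma gr_obj_columns: "gr_obj B X = - (\<Sum>i\<in>UNIV. column i X \<bullet> (B *v column i X))"
  by (simp add: gr_obj_def trace_def matrix_mul_assoc[symmetric] transpose_mult_component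
      column_matrix_mult)

lemma gr_grad_tangent:
  assumes "transpose X ** X = mat 1"
  shows "transpose X ** gr_grad A X = 0"
proof -
  have "transpose X ** (mat 1 - X ** transpose X) = 0"
    by (simp add: matrix_diff_ldistrib matrix_mul_assoc assms)
  then have "(- 2) *\<^sub>R (transpose X ** (mat 1 - X ** transpose X) ** A ** X) = 0" by simp
  then show ?thesis
    by (simp only: gr_grad_def matrix_scalar_ac scalar_matrix_assoc[symmetric] matrix_mul_assoc)
qed

lemma inner_gr_grad:
  assumes "transpose X ** G = 0"
  shows "gr_grad B X \<bullet> G = - 2 * ((B ** X) \<bullet> G)"
proof -
  have "(X ** (transpose X ** (B ** X))) \<bullet> G = 0"
    by (subst inner_mult_left) (simp add: assms)
  then show ?thesis
    by (simp add: gr_grad_def matrix_diff_rdistrib inner_diff_left matrix_mul_assoc)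
qed

text \<open>Along the unit-speed curve \<open>w\<close> the function \<open>h t = - (w t \<bullet> (B *v w t))\<close> has second derivative
  \<open>2 (w t \<bullet> (B *v w t) - w' t \<bullet> (B *v w' t)) \<le> 2 (b - a)\<close>, because \<open>w t\<close> and \<open>w' t\<close> are unit
  vectors. The right-hand side is the corresponding second-order Taylor bound at \<open>0\<close>.\<close>

lemma geodesic_upper_bound:
  fixes B :: "real^'n^'n" and x u :: "real^'n"
  assumes sym: "transpose B = B"
    and lower: "\<And>z. a * (norm z)\<^sup>2 \<le> z \<bullet> (B *v z)" and upper: "\<And>z. z \<bullet> (B *v z) \<le> b * (norm z)\<^sup>2"
    and xu: "norm x = 1" "norm u = 1" "x \<bullet> u = 0" and "0 \<le> s"
  defines "w \<equiv> \<lambda>t. cos t *\<^sub>R x + sin t *\<^sub>R u"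
  shows "- (w s \<bullet> (B *v w s)) \<le> - (x \<bullet> (B *v x)) - 2 * s * ((B *v x) \<bullet> u) + (b - a) * s\<^sup>2"
proof -
  define p q r where "p = x \<bullet> (B *v x)" and "q = (B *v x) \<bullet> u" and "r = u \<bullet> (B *v u)"
  have xBu: "x \<bullet> (B *v u) = q" "u \<bullet> (B *v x) = q"
    using symmetric_inner_swap[OF sym, of x u] by (simp_all add: q_def inner_commute)
  have quad: "(c *\<^sub>R x + d *\<^sub>R u) \<bullet> (B *v (c *\<^sub>R x + d *\<^sub>R u)) = c\<^sup>2 * p + 2 * c * d * q + d\<^sup>2 * r" for c d
    by (simp add: matrix_vector_right_distrib matrix_vector_mult_scaleR inner_add xBu
        p_def[symmetric] r_def[symmetric] power2_eq_square algebra_simps)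
  have nrm: "(norm (c *\<^sub>R x + d *\<^sub>R u))\<^sup>2 = c\<^sup>2 + d\<^sup>2" for c d
    using xu unfolding power2_norm_eq_inner
    by (simp add: inner_add inner_commute norm_eq_1 power2_eq_square)
  have up: "(cos t)\<^sup>2 * p + 2 * cos t * sin t * q + (sin t)\<^sup>2 * r \<le> b" for t
    using upper[of "cos t *\<^sub>R x + sin t *\<^sub>R u"] by (simp add: quad nrm)
  have lo: "a \<le> (sin t)\<^sup>2 * p - 2 * cos t * sin t * q + (cos t)\<^sup>2 * r" for t
    using lower[of "- sin t *\<^sub>R x + cos t *\<^sub>R u"] unfolding quad nrm by (simp add: mult_ac)
  \<comment> \<open>Right-hand side minus left-hand side, with its first two derivatives.\<close>
  define F where "F t = (b - a) * t\<^sup>2 - 2 * t * q - p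
    + ((cos t)\<^sup>2 * p + 2 * cos t * sin t * q + (sin t)\<^sup>2 * r)" for t
  define F1 where "F1 t = 2 * (b - a) * t - 2 * q
    + (- 2 * cos t * sin t * p + 2 * ((cos t)\<^sup>2 - (sin t)\<^sup>2) * q + 2 * sin t * cos t * r)" for t
  define F2 where "F2 t = 2 * (b - a)
    + 2 * (((sin t)\<^sup>2 - (cos t)\<^sup>2) * p - 4 * sin t * cos t * q + ((cos t)\<^sup>2 - (sin t)\<^sup>2) * r)" for t
  have D: "(F has_real_derivative F1 t) (at t)" for t
    unfolding F_def F1_def by (auto intro!: derivative_eq_intros simp: power2_eq_square algebra_simps)
  have D1: "(F1 has_real_derivative F2 t) (at t)" for t
    unfolding F1_def F2_def by (auto intro!: derivative_eq_intros simp: power2_eq_square algebra_simps)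
  have F2: "0 \<le> F2 t" for t
    using up[of t] lo[of t] unfolding F2_def by (simp add: algebra_simps)
  have F1: "0 \<le> F1 t" if "0 \<le> t" for t
    using DERIV_nonneg_imp_nondecreasing[OF that, of F1] D1 F2 by (force simp: F1_def)
  have "F 0 \<le> F s"
    using DERIV_nonneg_imp_nondecreasing[OF \<open>0 \<le> s\<close>, of F] D F1 by blast
  then show ?thesis
    unfolding w_def quad by (simp add: F_def p_def q_def algebra_simps)
qed

text \<open>Unpacks the choice of decomposition in the exponential map. Tangency of \<open>G\<close> makes the columns of
  \<open>X V\<close> orthogonal to those left singular vectors whose singular value is nonzero; where it is
  zero the sine vanishes. Hence the matrix of the exponential map has orthonormal columns and
  determines the projection onto the new subspace.\<close>

lemma gr_exp_svd:
  fixes X G :: "real^'k^'n"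
  assumes k: "CARD('k) \<le> CARD('n)" and X: "transpose X ** X = mat 1" and G: "transpose X ** G = 0"
    and X': "represents X' (gr_exp X G)"
  obtains U \<sigma> V where "compact_svd G U \<sigma> V"
    "\<And>i j. \<sigma> $ j \<noteq> 0 \<Longrightarrow> column i (X ** V) \<bullet> column j U = 0"
    "col_proj X' = col_proj (X ** V ** diag_mat (\<chi> i. cos (\<sigma> $ i)) + U ** diag_mat (\<chi> i. sin (\<sigma> $ i)))"
proof -
  obtain U \<sigma> V where USV: "(SOME (U, \<sigma>, V). compact_svd G U \<sigma> V) = (U, \<sigma>, V)"
    by (metis prod_cases3)
  have "\<exists>p. case p of (U, \<sigma>, V) \<Rightarrow> compact_svd G U \<sigma> V"
    using compact_svd_exists[OF k, of G] by auto
  from someI_ex[OF this] have svd: "compact_svd G U \<sigma> V" by (simp add: USV)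
  let ?W = "X ** V ** diag_mat (\<chi> i. cos (\<sigma> $ i)) + U ** diag_mat (\<chi> i. sin (\<sigma> $ i))"
  have V: "transpose V ** V = mat 1" and U: "transpose U ** U = mat 1"
    using svd by (auto simp: compact_svd_def orthogonal_matrix_def)
  have "transpose (X ** V) ** (X ** V) = transpose V ** (transpose X ** X) ** V"
    by (simp add: matrix_transpose_mul matrix_mul_assoc)
  then have XV: "transpose (X ** V) ** (X ** V) = mat 1" by (simp add: X V)
  have perp: "column i (X ** V) \<bullet> column j U = 0" if "\<sigma> $ j \<noteq> 0" for i j
  proof -
    have "transpose (X ** V) ** (U ** diag_mat \<sigma>) = transpose V ** (transpose X ** G) ** V"
      by (simp add: compact_svd_mult[OF svd, symmetric] matrix_transpose_mul matrix_mul_assoc)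
    then have "(transpose (X ** V) ** (U ** diag_mat \<sigma>)) $ i $ j = 0" by (simp add: G)
    then show ?thesis using that by (simp add: transpose_mult_component column_mult_diag_mat)
  qed
  have s0: "sin (\<sigma> $ j) * (column i (X ** V) \<bullet> column j U) = 0"
    "sin (\<sigma> $ j) * (c * (column i (X ** V) \<bullet> column j U)) = 0" for i j c
    using perp[of j i] by (cases "\<sigma> $ j = 0"; auto)+
  then have "transpose ?W ** ?W = mat 1"
    using XV U unfolding orthonormal_columns_iff
    by (auto simp: column_add column_mult_diag_mat inner_add inner_commute[of "column _ U" "column _ (X ** V)"] s0
        distrib_left)
  moreover have "span (columns X') = span (columns ?W)" "transpose X' ** X' = mat 1"
    using X' by (auto simp: represents_def gr_exp_def USV)
  ultimately show ?thesis
    using that[OF svd perp] col_proj_eq_if_span_eq by blast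
qed

text \<open>The smoothness inequality, for a quadratic form with spectrum in \<open>[a, b]\<close>. Both the objective and
  the chordal distance to a fixed subspace are of the form \<open>gr_obj B\<close>, so the same lemma controls
  the two. In an SVD of \<open>G\<close> the geodesic splits into planar rotations of the columns of
  \<open>X V\<close>, and \<open>geodesic_upper_bound\<close> applies to each of them.\<close>

lemma gr_obj_exp_le:
  fixes X G :: "real^'k^'n" and B :: "real^'n^'n"
  assumes k: "CARD('k) \<le> CARD('n)" and X: "transpose X ** X = mat 1" and G: "transpose X ** G = 0"
    and X': "represents X' (gr_exp X G)"
    and sym: "transpose B = B"
    and lower: "\<And>z. a * (norm z)\<^sup>2 \<le> z \<bullet> (B *v z)" and upper: "\<And>z. z \<bullet> (B *v z) \<le> b * (norm z)\<^sup>2"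
  shows "gr_obj B X' \<le> gr_obj B X + gr_grad B X \<bullet> G + (b - a) * (norm G)\<^sup>2"
proof -
  obtain U \<sigma> V where svd: "compact_svd G U \<sigma> V"
    and perp: "\<And>i j. \<sigma> $ j \<noteq> 0 \<Longrightarrow> column i (X ** V) \<bullet> column j U = 0"
    and proj: "col_proj X' = col_proj (X ** V ** diag_mat (\<chi> i. cos (\<sigma> $ i)) + U ** diag_mat (\<chi> i. sin (\<sigma> $ i)))"
    using gr_exp_svd[OF k X G X'] by blast
  let ?W = "X ** V ** diag_mat (\<chi> i. cos (\<sigma> $ i)) + U ** diag_mat (\<chi> i. sin (\<sigma> $ i))"
  have V: "orthogonal_matrix V" "transpose V ** V = mat 1" "V ** transpose V = mat 1"
    and U: "transpose U ** U = mat 1" and \<sigma>: "\<And>i. 0 \<le> \<sigma> $ i"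
    using svd by (auto simp: compact_svd_def orthogonal_matrix_def)
  have "transpose (X ** V) ** (X ** V) = transpose V ** (transpose X ** X) ** V"
    by (simp add: matrix_transpose_mul matrix_mul_assoc)
  then have XV: "transpose (X ** V) ** (X ** V) = mat 1" by (simp add: X V)
  have "col_proj (X ** V) = X ** (V ** transpose V) ** transpose X"
    by (simp add: col_proj_def matrix_transpose_mul matrix_mul_assoc)
  then have projXV: "col_proj (X ** V) = col_proj X" by (simp add: V col_proj_def)
  define x u where "x i = column i (X ** V)" and "u i = column i U" for i
  have x1: "norm (x i) = 1" and u1: "norm (u i) = 1" for i
    using XV U by (simp_all add: orthonormal_columns_iff norm_eq_1 x_def u_def)
  have "- (column i ?W \<bullet> (B *v column i ?W))
      \<le> - (x i \<bullet> (B *v x i)) - 2 * \<sigma> $ i * ((B *v x i) \<bullet> u i) + (b - a) * (\<sigma> $ i)\<^sup>2" for i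
  proof (cases "\<sigma> $ i = 0")
    case False
    then have "x i \<bullet> u i = 0" using perp by (simp add: x_def u_def)
    from geodesic_upper_bound[OF sym lower upper x1 u1 this \<sigma>]
    show ?thesis by (simp add: column_add column_mult_diag_mat x_def u_def)
  qed (simp add: column_add column_mult_diag_mat x_def)
  then have "gr_obj B ?W \<le> (\<Sum>i\<in>UNIV. - (x i \<bullet> (B *v x i)) - 2 * \<sigma> $ i * ((B *v x i) \<bullet> u i)
      + (b - a) * (\<sigma> $ i)\<^sup>2)"
    unfolding gr_obj_columns sum_negf[symmetric] by (rule sum_mono)
  also have "\<dots> = gr_obj B (X ** V) - 2 * ((B ** X ** V) \<bullet> (G ** V)) + (b - a) * (norm G)\<^sup>2"
    by (simp add: gr_obj_columns x_def u_def sum.distrib sum_subtractf sum_negf norm_compact_svd[OF svd]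
        compact_svd_mult[OF svd] inner_matrix_columns column_mult_diag_mat sum_distrib_left
        matrix_mul_assoc[symmetric] column_matrix_mult[of _ B] mult_ac)
  also have "(B ** X ** V) \<bullet> (G ** V) = (B ** X) \<bullet> G"
    by (rule inner_mult_orthogonal) (rule V)
  also have "gr_obj B (X ** V) = gr_obj B X" by (simp add: gr_obj_col_proj projXV)
  finally show ?thesis
    by (simp add: gr_obj_col_proj proj inner_gr_grad[OF G])
qed

section \<open>The chordal distance\<close>

text \<open>For orthonormal columns this is the sum of \<open>sin\<^sup>2 \<theta>\<^sub>i\<close> over the principal angles, because the
  \<open>cos \<theta>\<^sub>i\<close> are the singular values of \<open>Y\<^sup>T X\<close>. Written without angles it is affine in each of the two
  projections.\<close>

definition chordal_sq :: "real^'k^'n \<Rightarrow> real^'k^'n \<Rightarrow> real" where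
  "chordal_sq X Y = real CARD('k) - (norm (transpose Y ** X))\<^sup>2"

lemma norm_cross_sq:
  fixes X Y :: "real^'k^'n"
  shows "(norm (transpose Y ** X))\<^sup>2 = trace (col_proj Y ** col_proj X)"
proof -
  have "(norm (transpose Y ** X))\<^sup>2 = trace (transpose X ** (Y ** transpose Y ** X))"
    by (simp add: power2_norm_eq_inner inner_matrix_trace matrix_transpose_mul matrix_mul_assoc)
  also have "\<dots> = trace (col_proj Y ** col_proj X)"
    by (subst trace_mul_sym) (simp add: col_proj_def matrix_mul_assoc)
  finally show ?thesis .
qed

lemma chordal_sq_eq_gr_obj:
  fixes X Y :: "real^'k^'n"
  shows "chordal_sq X Y = real CARD('k) + gr_obj (col_proj Y) X"
  by (simp add: chordal_sq_def norm_cross_sq gr_obj_col_proj)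

text \<open>These Frobenius norms dominate the operator norms, which is how the chordal distance bounds the
  action of one projection on the range, or on the kernel, of the other.\<close>

lemma chordal_sq_eq_norm:
  fixes X Y :: "real^'k^'n"
  assumes X: "transpose X ** X = mat 1" and Y: "transpose Y ** Y = mat 1"
  shows "chordal_sq X Y = (norm ((mat 1 - col_proj Y) ** col_proj X))\<^sup>2"
    and "chordal_sq X Y = (norm (col_proj Y ** (mat 1 - col_proj X)))\<^sup>2"
proof -
  have idem: "col_proj X ** col_proj X = col_proj X" "col_proj Y ** col_proj Y = col_proj Y"
    by (rule col_proj_idem_mult[OF X], rule col_proj_idem_mult[OF Y])
  have cyc: "trace (col_proj X ** col_proj Y ** col_proj X) = trace (col_proj Y ** col_proj X)"
    "trace (col_proj X ** col_proj Y) = trace (col_proj Y ** col_proj X)"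
    using trace_mul_sym[of "col_proj X ** col_proj Y" "col_proj X"]
      trace_mul_sym[of "col_proj X" "col_proj Y"]
    by (simp_all add: matrix_mul_assoc idem)
  have "transpose ((mat 1 - col_proj Y) ** col_proj X) ** ((mat 1 - col_proj Y) ** col_proj X)
      = col_proj X ** col_proj X - col_proj X ** col_proj Y ** col_proj X
        - (col_proj X ** col_proj Y ** col_proj X - col_proj X ** (col_proj Y ** col_proj Y) ** col_proj X)"
    by (simp add: matrix_transpose_mul transpose_diff matrix_diff_ldistrib matrix_diff_rdistrib matrix_mul_assoc)
  then show "chordal_sq X Y = (norm ((mat 1 - col_proj Y) ** col_proj X))\<^sup>2"
    by (simp add: power2_norm_eq_inner inner_matrix_trace idem trace_sub cyc chordal_sq_def norm_cross_sq[unfolded power2_norm_eq_inner inner_matrix_trace]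
        trace_col_proj[OF X])
  have "transpose (col_proj Y ** (mat 1 - col_proj X)) ** (col_proj Y ** (mat 1 - col_proj X))
      = col_proj Y ** col_proj Y - col_proj Y ** col_proj Y ** col_proj X
        - (col_proj X ** (col_proj Y ** col_proj Y) - col_proj X ** (col_proj Y ** col_proj Y) ** col_proj X)"
    by (simp add: matrix_transpose_mul transpose_diff matrix_diff_ldistrib matrix_diff_rdistrib matrix_mul_assoc)
  then show "chordal_sq X Y = (norm (col_proj Y ** (mat 1 - col_proj X)))\<^sup>2"
    by (simp add: power2_norm_eq_inner inner_matrix_trace idem trace_sub cyc chordal_sq_def norm_cross_sq[unfolded power2_norm_eq_inner inner_matrix_trace]
        trace_col_proj[OF Y])
qed

lemma col_proj_norm_lower:
  fixes X Y :: "real^'k^'n"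
  assumes X: "transpose X ** X = mat 1" and Y: "transpose Y ** Y = mat 1"
    and z: "col_proj X *v z = z"
  shows "(1 - chordal_sq X Y) * (norm z)\<^sup>2 \<le> (norm (col_proj Y *v z))\<^sup>2"
proof -
  have "((mat 1 - col_proj Y) ** col_proj X) *v z = z - col_proj Y *v z"
    by (simp add: matrix_vector_mul_assoc[symmetric] z matrix_vector_mult_diff_rdistrib)
  with norm_matrix_vector_mult_le[of "(mat 1 - col_proj Y) ** col_proj X" z]
  have "(norm (z - col_proj Y *v z))\<^sup>2 \<le> chordal_sq X Y * (norm z)\<^sup>2"
    by (simp add: chordal_sq_eq_norm(1)[OF X Y])
  then show ?thesis
    by (simp add: col_proj_Pythagoras[OF Y] algebra_simps)
qed

lemma col_proj_norm_upper:
  fixes X Y :: "real^'k^'n"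
  assumes X: "transpose X ** X = mat 1" and Y: "transpose Y ** Y = mat 1"
    and w: "col_proj X *v w = 0"
  shows "(norm (col_proj Y *v w))\<^sup>2 \<le> chordal_sq X Y * (norm w)\<^sup>2"
proof -
  have "(col_proj Y ** (mat 1 - col_proj X)) *v w = col_proj Y *v w"
    by (simp add: matrix_vector_mul_assoc[symmetric] w matrix_vector_mult_diff_rdistrib)
  with norm_matrix_vector_mult_le[of "col_proj Y ** (mat 1 - col_proj X)" w]
  show ?thesis by (simp add: chordal_sq_eq_norm(2)[OF X Y])
qed

text \<open>The singular values of \<open>Y\<^sup>T X\<close> lie in \<open>[0, 1]\<close> since \<open>X\<close> is an isometry and \<open>Y\<^sup>T\<close> a contraction, so
  they are cosines.\<close>

lemma principal_angles_exist:
  fixes X Y :: "real^'k^'n"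
  assumes X: "transpose X ** X = mat 1" and Y: "transpose Y ** Y = mat 1"
  shows "\<exists>\<theta>. principal_angles X Y \<theta>"
proof -
  obtain P \<sigma> Q where svd: "compact_svd (transpose Y ** X) P \<sigma> Q"
    using compact_svd_exists[of "transpose Y ** X"] by auto
  have P: "transpose P ** P = mat 1" and Q: "transpose Q ** Q = mat 1" and \<sigma>: "\<And>i. 0 \<le> \<sigma> $ i"
    using svd by (auto simp: compact_svd_def orthogonal_matrix_def)
  have "\<sigma> $ i \<le> 1" for i
  proof -
    have XX: "(X *v z) \<bullet> (X *v z) = z \<bullet> ((transpose X ** X) *v z)" for z
      by (metis dot_lmul_matrix inner_commute matrix_vector_mul_assoc transpose_matrix_vector)
    have "column i (transpose Y ** X ** Q) = \<sigma> $ i *\<^sub>R column i P"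
      by (simp add: compact_svd_mult[OF svd] column_mult_diag_mat)
    then have "transpose Y *v (X *v column i Q) = \<sigma> $ i *\<^sub>R column i P"
      by (simp add: column_matrix_mult matrix_vector_mul_assoc[symmetric])
    then have "\<sigma> $ i = norm (transpose Y *v (X *v column i Q))"
      using P \<sigma>[of i] by (simp add: orthonormal_columns_iff norm_eq_1)
    also have "\<dots> \<le> norm (X *v column i Q)" by (rule norm_transpose_mult_le[OF Y])
    also have "\<dots> = 1"
      using Q by (simp add: norm_eq_1 XX X orthonormal_columns_iff)
    finally show ?thesis .
  qed
  then have bd: "-1 \<le> \<sigma> $ i \<and> \<sigma> $ i \<le> 1" for i
    using \<sigma>[of i] by (smt (verit))
  have "arccos (\<sigma> $ i) \<le> pi / 2" for i
    using bd \<sigma> by (intro arccos_le_pi2) auto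
  moreover have "(\<chi> i. cos ((\<chi> i. arccos (\<sigma> $ i)) $ i)) = \<sigma>"
    using bd by (simp add: vec_eq_iff)
  ultimately have "principal_angles X Y (\<chi> i. arccos (\<sigma> $ i))"
    using svd bd by (auto simp: principal_angles_def arccos_lbound)
  then show ?thesis ..
qed

text \<open>This is \<open>sin\<^sup>2 \<theta> \<le> \<theta>\<^sup>2\<close>, summed over the principal angles.\<close>

lemma chordal_sq_le_gr_dist_sq:
  fixes X Y :: "real^'k^'n"
  assumes X: "transpose X ** X = mat 1" and Y: "transpose Y ** Y = mat 1"
  shows "chordal_sq X Y \<le> (gr_dist X Y)\<^sup>2"
proof -
  define \<theta> where "\<theta> = (SOME \<theta>. principal_angles X Y \<theta>)"
  have "principal_angles X Y \<theta>"
    unfolding \<theta>_def using principal_angles_exist[OF X Y] by (rule someI_ex)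
  then obtain P Q where svd: "compact_svd (transpose Y ** X) P (\<chi> i. cos (\<theta> $ i)) Q"
    by (auto simp: principal_angles_def)
  have "chordal_sq X Y = (\<Sum>i\<in>UNIV. (sin (\<theta> $ i))\<^sup>2)"
    by (simp add: chordal_sq_def norm_compact_svd[OF svd] sin_squared_eq sum_subtractf)
  also have "\<dots> \<le> (\<Sum>i\<in>UNIV. (\<theta> $ i)\<^sup>2)"
    by (intro sum_mono) (simp add: abs_sin_x_le_abs_x abs_le_square_iff[symmetric])
  also have "\<dots> = (gr_dist X Y)\<^sup>2"
    by (simp add: gr_dist_def \<theta>_def Let_def sum_nonneg)
  finally show ?thesis .
qed

section \<open>Spectral estimates\<close>

text \<open>The locale below numbers eigenvectors from \<open>1\<close>; the range \<open>{1..k}\<close> should not be rewritten to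
  start at \<open>Suc 0\<close>.\<close>

declare One_nat_def [simp del]

locale ordered_eigenbasis =
  fixes A :: "real^'n^'n" and lam :: "nat \<Rightarrow> real" and v :: "nat \<Rightarrow> real^'n" and Y :: "real^'k^'n"
  assumes k_less_n: "CARD('k) < CARD('n)"
    and A_sym: "transpose A = A"
    and lam_decreasing: "\<And>i j. 1 \<le> i \<Longrightarrow> i \<le> j \<Longrightarrow> j \<le> CARD('n) \<Longrightarrow> lam j \<le> lam i"
    and eigenvector: "\<And>i. i \<in> {1..CARD('n)} \<Longrightarrow> A *v v i = lam i *\<^sub>R v i"
    and orthonormal: "\<And>i j. i \<in> {1..CARD('n)} \<Longrightarrow> j \<in> {1..CARD('n)}
        \<Longrightarrow> v i \<bullet> v j = (if i = j then 1 else 0)"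
    and Y_represents: "represents Y (span (v ` {1..CARD('k)}))"
begin

lemma Y_orth: "transpose Y ** Y = mat 1"
  using Y_represents by (simp add: represents_def)

lemma trace_eigenbasis: "trace M = (\<Sum>i=1..CARD('n). v i \<bullet> (M *v v i))"
  by (rule trace_orthonormal_basis) (auto simp: orthonormal)

lemma inner_eigenbasis: "x \<bullet> y = (\<Sum>i=1..CARD('n). (v i \<bullet> x) * (v i \<bullet> y))"
  by (rule inner_orthonormal_basis) (auto simp: orthonormal)

lemma inner_A: "i \<in> {1..CARD('n)} \<Longrightarrow> v i \<bullet> (A *v x) = lam i * (v i \<bullet> x)"
  using symmetric_inner_swap[OF A_sym, of "v i" x] by (simp add: eigenvector)

lemma Rayleigh_bounds:
  shows "lam CARD('n) * (norm x)\<^sup>2 \<le> x \<bullet> (A *v x)" and "x \<bullet> (A *v x) \<le> lam 1 * (norm x)\<^sup>2"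
proof -
  have Ax: "x \<bullet> (A *v x) = (\<Sum>i=1..CARD('n). lam i * (v i \<bullet> x)\<^sup>2)"
    unfolding inner_eigenbasis[of x "A *v x"]
    by (intro sum.cong) (auto simp: inner_A power2_eq_square)
  have xx: "(norm x)\<^sup>2 = (\<Sum>i=1..CARD('n). (v i \<bullet> x)\<^sup>2)"
    unfolding power2_norm_eq_inner inner_eigenbasis[of x x] by (simp add: power2_eq_square)
  show "lam CARD('n) * (norm x)\<^sup>2 \<le> x \<bullet> (A *v x)"
    unfolding Ax xx sum_distrib_left by (intro sum_mono mult_right_mono lam_decreasing) auto
  show "x \<bullet> (A *v x) \<le> lam 1 * (norm x)\<^sup>2"
    unfolding Ax xx sum_distrib_left by (intro sum_mono mult_right_mono lam_decreasing) auto
qed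

lemma Y_proj_leading: "i \<in> {1..CARD('k)} \<Longrightarrow> col_proj Y *v v i = v i"
  using Y_represents by (intro col_proj_fixes_span) (auto simp: represents_def span_base)

lemma Y_proj_trailing:
  assumes "i \<in> {CARD('k)<..CARD('n)}"
  shows "col_proj Y *v v i = 0"
proof -
  have "v i \<bullet> y = 0" if "y \<in> span (v ` {1..CARD('k)})" for y
    using that
  proof (rule span_induct)
    show "subspace {y. v i \<bullet> y = 0}" by (simp add: subspace_hyperplane)
  qed (use assms k_less_n orthonormal in auto)
  then have "v i \<bullet> (col_proj Y *v v i) = 0"
    using Y_represents col_proj_in_span[of Y "v i"] by (auto simp: represents_def)
  then show ?thesis by (simp add: col_proj_norm[OF Y_orth])
qed

lemma sum_split_leading: "(\<Sum>i=1..CARD('n). g i) = (\<Sum>i=1..CARD('k). g i) + (\<Sum>i\<in>{CARD('k)<..CARD('n)}. g i)"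
  for g :: "nat \<Rightarrow> real"
proof -
  have "{1..CARD('n)} = {1..CARD('k)} \<union> {CARD('k)<..CARD('n)}"
    using k_less_n by auto
  moreover have "sum g ({1..CARD('k)} \<union> {CARD('k)<..CARD('n)})
      = (\<Sum>i=1..CARD('k). g i) + (\<Sum>i\<in>{CARD('k)<..CARD('n)}. g i)"
    by (rule sum.union_disjoint) auto
  ultimately show ?thesis by simp
qed

text \<open>Equal masses on the leading and on the trailing indices are separated by the value
  \<open>lam k\<close>, so the leading one has the larger weighted sum.\<close>

lemma weighted_sum_exchange:
  assumes "\<And>i. i \<in> {1..CARD('k)} \<Longrightarrow> 0 \<le> \<alpha> i" and "\<And>i. i \<in> {CARD('k)<..CARD('n)} \<Longrightarrow> 0 \<le> \<beta> i"
    and "(\<Sum>i=1..CARD('k). \<alpha> i) = (\<Sum>i\<in>{CARD('k)<..CARD('n)}. \<beta> i)"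
  shows "(\<Sum>i\<in>{CARD('k)<..CARD('n)}. lam i * \<beta> i) \<le> (\<Sum>i=1..CARD('k). lam i * \<alpha> i)"
proof -
  have "(\<Sum>i\<in>{CARD('k)<..CARD('n)}. lam i * \<beta> i) \<le> (\<Sum>i\<in>{CARD('k)<..CARD('n)}. lam CARD('k) * \<beta> i)"
    by (intro sum_mono mult_right_mono lam_decreasing assms) (auto simp: Suc_leI One_nat_def)
  also have "\<dots> = (\<Sum>i=1..CARD('k). lam CARD('k) * \<alpha> i)"
    by (simp add: sum_distrib_left[symmetric] assms(3))
  also have "\<dots> \<le> (\<Sum>i=1..CARD('k). lam i * \<alpha> i)"
    using k_less_n by (intro sum_mono mult_right_mono lam_decreasing assms) auto
  finally show ?thesis .
qed

definition fmin :: real where "fmin = - (\<Sum>i=1..CARD('k). lam i)"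

context
  fixes X :: "real^'k^'n"
  assumes X: "transpose X ** X = mat 1"
begin

text \<open>The squared length of the part of \<open>v i\<close> in the subspace, that is, the \<open>i\<close>-th diagonal entry of the
  projection in the eigenbasis. These numbers lie in \<open>[0, 1]\<close> and sum to \<open>k\<close>, and both the
  objective and the squared chordal distance are affine functions of them.\<close>

definition weight :: "nat \<Rightarrow> real" where
  "weight i = (norm (col_proj X *v v i))\<^sup>2"

lemma weight_inner: "v i \<bullet> (col_proj X *v v i) = weight i"
  by (simp add: weight_def col_proj_norm[OF X])

lemma weight_bounds: "0 \<le> weight i" "i \<in> {1..CARD('n)} \<Longrightarrow> weight i \<le> 1"
proof -
  show "weight i \<le> 1" if "i \<in> {1..CARD('n)}"
  proof -
    have "(norm (v i))\<^sup>2 = 1" using orthonormal[OF that that] by (simp add: power2_norm_eq_inner)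
    then show ?thesis
      using col_proj_Pythagoras[OF X, of "v i"] zero_le_power2[of "norm (v i - col_proj X *v v i)"]
      by (simp add: weight_def)
  qed
qed (simp add: weight_def)

lemma sum_weight: "(\<Sum>i=1..CARD('n). weight i) = CARD('k)"
  using trace_eigenbasis[of "col_proj X"] by (simp add: weight_inner trace_col_proj[OF X])

lemma chordal_sq_weight: "chordal_sq X Y = (\<Sum>i=1..CARD('k). 1 - weight i)"
proof -
  have "trace (col_proj Y ** col_proj X) = (\<Sum>i=1..CARD('n). (col_proj Y *v v i) \<bullet> (col_proj X *v v i))"
    by (simp add: trace_eigenbasis matrix_vector_mul_assoc[symmetric] col_proj_inner)
  also have "\<dots> = (\<Sum>i=1..CARD('k). weight i)"
    by (simp add: sum_split_leading Y_proj_leading Y_proj_trailing weight_inner)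
  finally show ?thesis
    by (simp add: chordal_sq_def norm_cross_sq sum_subtractf)
qed

lemma chordal_sq_weight': "chordal_sq X Y = (\<Sum>i\<in>{CARD('k)<..CARD('n)}. weight i)"
  using sum_weight by (simp add: chordal_sq_weight sum_split_leading sum_subtractf)

lemma gap_weight:
  "gr_obj A X - fmin = (\<Sum>i=1..CARD('k). lam i * (1 - weight i))
     - (\<Sum>i\<in>{CARD('k)<..CARD('n)}. lam i * weight i)"
proof -
  have "trace (A ** col_proj X) = (\<Sum>i=1..CARD('n). lam i * weight i)"
    unfolding trace_eigenbasis matrix_vector_mul_assoc[symmetric]
    by (intro sum.cong) (auto simp: inner_A weight_inner)
  then show ?thesis
    by (simp add: gr_obj_col_proj fmin_def sum_split_leading sum_subtractf right_diff_distrib)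
qed

lemma gap_nonneg: "0 \<le> gr_obj A X - fmin"
proof -
  have "(\<Sum>i\<in>{CARD('k)<..CARD('n)}. lam i * weight i) \<le> (\<Sum>i=1..CARD('k). lam i * (1 - weight i))"
    using weight_bounds k_less_n chordal_sq_weight chordal_sq_weight' by (intro weighted_sum_exchange) auto
  then show ?thesis by (simp add: gap_weight)
qed

lemma gap_le_chordal: "gr_obj A X - fmin \<le> (lam 1 - lam CARD('n)) * chordal_sq X Y"
proof -
  have "(\<Sum>i=1..CARD('k). lam i * (1 - weight i)) \<le> (\<Sum>i=1..CARD('k). lam 1 * (1 - weight i))"
    using k_less_n weight_bounds by (intro sum_mono mult_right_mono lam_decreasing) auto
  moreover have "(\<Sum>i\<in>{CARD('k)<..CARD('n)}. lam CARD('n) * weight i) \<le> (\<Sum>i\<in>{CARD('k)<..CARD('n)}. lam i * weight i)"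
    using weight_bounds by (intro sum_mono mult_right_mono lam_decreasing) auto
  ultimately show ?thesis
    unfolding gap_weight left_diff_distrib
    unfolding sum_distrib_left[symmetric] chordal_sq_weight[symmetric] chordal_sq_weight'[symmetric]
    by linarith
qed

text \<open>The gradient of the objective is correlated with that of the chordal distance: a substitute for
  geodesic convexity towards \<open>Y\<close>. In the eigenbasis the right-hand side is \<open>4\<close> times
  \<open>\<Sum>i\<le>k. lam i (weight i - r i) - \<Sum>i>k. lam i r i\<close>, where \<open>r i\<close> is the squared length of the
  projection of \<open>v i\<close> first onto the span of \<open>X\<close>, then onto that of \<open>Y\<close>. Subtracting
  \<open>c = 1 - chordal_sq X Y\<close> times the gap leaves nonnegative coefficients of equal mass on both
  sides, by \<open>col_proj_norm_lower\<close> and \<open>col_proj_norm_upper\<close>, and \<open>weighted_sum_exchange\<close>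
  applies.\<close>

lemma grad_inner_ge:
  "4 * (1 - chordal_sq X Y) * (gr_obj A X - fmin) \<le> gr_grad (col_proj Y) X \<bullet> gr_grad A X"
proof -
  define c where "c = 1 - chordal_sq X Y"
  define z where "z i = col_proj X *v v i" for i
  define r where "r i = (norm (col_proj Y *v z i))\<^sup>2" for i
  have Xz: "col_proj X *v z i = z i" for i
    by (simp add: z_def col_proj_idem[OF X])
  have r: "z i \<bullet> (col_proj Y *v z i) = r i" "(col_proj Y *v z i) \<bullet> z i = r i" for i
    by (simp_all add: r_def col_proj_norm[OF Y_orth] inner_commute[of "col_proj Y *v z i"])
  have w: "(norm (z i))\<^sup>2 = weight i" "v i \<bullet> z i = weight i" for i
    by (simp_all add: z_def weight_def col_proj_norm[OF X])
  have vv: "v i \<bullet> v i = 1" if "i \<in> {1..CARD('n)}" for i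
    using orthonormal[OF that that] by simp

  \<comment> \<open>Up to the factor \<open>4\<close>, the coefficients of \<open>lam i\<close> in the difference of the two sides are these
    numbers, with a minus sign for trailing \<open>i\<close>.\<close>
  have trailing: "0 \<le> r i - c * weight i" for i
    using col_proj_norm_lower[OF X Y_orth Xz] by (simp add: c_def r_def w)
  have leading: "0 \<le> weight i - r i - c * (1 - weight i)" if i: "i \<in> {1..CARD('k)}" for i
  proof -
    have "col_proj X *v (v i - z i) = 0"
      by (simp add: matrix_vector_mult_diff_distrib Xz) (simp add: z_def)
    from col_proj_norm_upper[OF X Y_orth this]
    have "(norm (v i - col_proj Y *v z i))\<^sup>2 \<le> (1 - c) * (norm (v i - z i))\<^sup>2"
      by (simp add: matrix_vector_mult_diff_distrib Y_proj_leading[OF i] c_def)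
    moreover have "(norm (v i - z i))\<^sup>2 = 1 - weight i"
      using col_proj_Pythagoras[OF X, of "v i"] vv[of i] i k_less_n
      by (simp add: z_def weight_def power2_norm_eq_inner[of "v i"])
    moreover have "v i \<bullet> (col_proj Y *v z i) = weight i"
      using Y_proj_leading[OF i] by (simp add: w flip: col_proj_inner)
    then have "(norm (v i - col_proj Y *v z i))\<^sup>2 = 1 - 2 * weight i + r i"
      using vv[of i] i k_less_n unfolding power2_norm_eq_inner
      by (simp add: inner_diff inner_commute) (simp add: r_def power2_norm_eq_inner)
    ultimately show ?thesis by (simp add: algebra_simps)
  qed

  \<comment> \<open>The two masses agree because both sides of the claim are unchanged when \<open>A\<close> is shifted by a
    multiple of the identity; in terms of weights this rests on the following trace identity.\<close>
  have "trace (col_proj X ** col_proj Y ** col_proj X) = trace (col_proj Y ** col_proj X)"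
    using trace_mul_sym[of "col_proj X ** col_proj Y" "col_proj X"]
      trace_mul_sym[of "col_proj X" "col_proj Y"]
    by (simp add: matrix_mul_assoc col_proj_idem_mult[OF X])
  then have sum_r: "(\<Sum>i=1..CARD('n). r i) = (\<Sum>i=1..CARD('k). weight i)"
    using chordal_sq_weight
    by (simp add: trace_eigenbasis[of "col_proj X ** col_proj Y ** col_proj X"]
        matrix_vector_mul_assoc[symmetric] chordal_sq_def norm_cross_sq sum_subtractf
        col_proj_inner[of X, symmetric] r flip: z_def)
  have "(\<Sum>i\<in>{CARD('k)<..CARD('n)}. lam i * (r i - c * weight i))
      \<le> (\<Sum>i=1..CARD('k). lam i * (weight i - r i - c * (1 - weight i)))"
  proof (rule weighted_sum_exchange)
    have "(\<Sum>i=1..CARD('k). 1 - weight i) = (\<Sum>i\<in>{CARD('k)<..CARD('n)}. weight i)"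
      using chordal_sq_weight chordal_sq_weight' by simp
    then show "(\<Sum>i=1..CARD('k). weight i - r i - c * (1 - weight i))
        = (\<Sum>i\<in>{CARD('k)<..CARD('n)}. r i - c * weight i)"
      using sum_r unfolding sum_split_leading
      by (simp only: sum_subtractf sum_distrib_left[symmetric])
  qed (use leading trailing in auto)
  then have main: "c * (gr_obj A X - fmin)
      \<le> (\<Sum>i=1..CARD('k). lam i * (weight i - r i)) - (\<Sum>i\<in>{CARD('k)<..CARD('n)}. lam i * r i)"
    unfolding gap_weight by (simp add: sum_subtractf sum.distrib sum_distrib_left algebra_simps)

  have "gr_grad (col_proj Y) X \<bullet> gr_grad A X = 4 * ((col_proj Y ** X) \<bullet> ((mat 1 - col_proj X) ** A ** X))"
    by (simp add: inner_gr_grad[OF gr_grad_tangent[OF X]]) (simp add: gr_grad_def col_proj_def)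
  also have "(col_proj Y ** X) \<bullet> ((mat 1 - col_proj X) ** A ** X)
      = trace (col_proj X ** (col_proj Y ** (mat 1 - col_proj X) ** A))"
    using trace_mul_sym[of X "transpose X ** (col_proj Y ** (mat 1 - col_proj X) ** A)"]
    by (simp add: inner_matrix_trace matrix_transpose_mul matrix_mul_assoc col_proj_def[of X])
  also have "\<dots> = (\<Sum>i=1..CARD('n). lam i * (z i \<bullet> (col_proj Y *v v i) - r i))"
    unfolding trace_eigenbasis
    by (intro sum.cong)
       (auto simp: matrix_vector_mul_assoc[symmetric] eigenvector matrix_vector_mult_scaleR
         matrix_vector_mult_diff_rdistrib matrix_vector_mult_diff_distrib inner_diff_right r
         simp flip: z_def col_proj_inner)
  also have "\<dots> = (\<Sum>i=1..CARD('k). lam i * (weight i - r i)) - (\<Sum>i\<in>{CARD('k)<..CARD('n)}. lam i * r i)"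
    by (simp add: sum_split_leading Y_proj_leading Y_proj_trailing inner_commute[of "z _"] w sum_negf)
  finally have "gr_grad (col_proj Y) X \<bullet> gr_grad A X
      = 4 * ((\<Sum>i=1..CARD('k). lam i * (weight i - r i)) - (\<Sum>i\<in>{CARD('k)<..CARD('n)}. lam i * r i))" .
  moreover have "4 * (c * (gr_obj A X - fmin)) \<le> 4 * ((\<Sum>i=1..CARD('k). lam i * (weight i - r i))
      - (\<Sum>i\<in>{CARD('k)<..CARD('n)}. lam i * r i))"
    by (rule mult_left_mono[OF main]) simp
  ultimately show ?thesis by (simp only: c_def[symmetric] mult.assoc)
qed

end

end

section \<open>The recursion for gap and distance\<close>

text \<open>Here \<open>m\<close> is the gap, \<open>P\<close> the squared chordal distance and \<open>m + g P\<close> the potential. The decrease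
  in \<open>step\<close> is only useful while \<open>P\<close> stays away from \<open>1\<close>, and the potential at time \<open>0\<close> may be
  too large to guarantee this. After one step, however, the potential is at most
  \<open>g P 0 + (2 P 0 - 1) m 0\<close>, and \<open>m 0 \<le> g P 0\<close> with \<open>P 0 \<le> 0.62\<close> bounds it by
  \<open>(0.62 + 0.24 \<cdot> 0.62) g < 0.8 g\<close>. From then on it is nonincreasing, so \<open>P \<le> 0.8\<close> at all times and
  each step lowers it by at least \<open>0.4 m\<close>.\<close>

lemma potential_sequence_bound:
  fixes m P :: "nat \<Rightarrow> real"
  assumes g: "0 < g" and m_nonneg: "\<And>t. 0 \<le> m t" and m_dec: "\<And>t. m (Suc t) \<le> m t"
    and m_le: "\<And>t. m t \<le> g * P t"
    and step: "\<And>t. m (Suc t) + g * P (Suc t) \<le> m t + g * P t - 2 * (1 - P t) * m t"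
    and P0: "P 0 \<le> 31 / 50"
  shows "m t * (2 / 5 * real t + 1) \<le> m 0 + g * P 0"
proof -
  have E1: "m (Suc t) + g * P (Suc t) \<le> 4 / 5 * g" for t
  proof (induction t)
    case 0
    have gP: "g * P 0 \<le> 31 / 50 * g" using P0 g by simp
    have "(2 * P 0 - 1) * m 0 \<le> 6 / 25 * m 0"
      using P0 m_nonneg[of 0] by (intro mult_right_mono) auto
    also have "6 / 25 * m 0 \<le> 6 / 25 * (31 / 50 * g)" using m_le[of 0] gP by simp
    finally have "(2 * P 0 - 1) * m 0 \<le> 93 / 625 * g" by simp
    moreover have "m 0 + g * P 0 - 2 * (1 - P 0) * m 0 = g * P 0 + (2 * P 0 - 1) * m 0"
      by (simp add: algebra_simps)
    ultimately show ?case using step[of 0] gP g by linarith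
  next
    case (Suc t)
    have "g * P (Suc t) \<le> g * 1" using Suc m_nonneg[of "Suc t"] g by linarith
    then have "P (Suc t) \<le> 1" using g by simp
    then have "0 \<le> (1 - P (Suc t)) * m (Suc t)" using m_nonneg[of "Suc t"] by simp
    then show ?case using step[of "Suc t"] Suc by linarith
  qed
  have P: "P t \<le> 4 / 5" for t
  proof (cases t)
    case (Suc s)
    have "g * P t \<le> g * (4 / 5)" using E1[of s] m_nonneg[of t] Suc by simp
    then show ?thesis using g by simp
  qed (use P0 in simp)
  \<comment> \<open>Since \<open>m\<close> decreases, the sum of its first \<open>t\<close> values is at least \<open>t * m t\<close>.\<close>
  have "m t + g * P t + 2 / 5 * real t * m t \<le> m 0 + g * P 0"
  proof (induction t)
    case (Suc t)
    have "2 / 5 * m t \<le> 2 * (1 - P t) * m t"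
      using P[of t] m_nonneg[of t] by (intro mult_right_mono) auto
    moreover have "2 / 5 * real (Suc t) * m (Suc t) \<le> 2 / 5 * real (Suc t) * m t"
      using m_dec[of t] by (intro mult_left_mono) auto
    moreover have "2 / 5 * real (Suc t) * m t = 2 / 5 * real t * m t + 2 / 5 * m t"
      by (simp add: algebra_simps)
    ultimately show ?case using step[of t] Suc by linarith
  qed simp
  moreover have "0 \<le> g * P t" using m_nonneg[of t] m_le[of t] by linarith
  ultimately show ?thesis by (simp add: algebra_simps)
qed

section \<open>The convergence rate\<close>

theorem theorem24:
  fixes A :: "real^'n^'n"
    and lam :: "nat \<Rightarrow> real" and v :: "nat \<Rightarrow> real^'n"
    and Y :: "real^'k^'n" and X :: "nat \<Rightarrow> real^'k^'n" and \<X> :: "nat \<Rightarrow> (real^'n) set"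
    and \<gamma> fstar :: real
  assumes "CARD('k) < CARD('n)"
    and "transpose A = A"
    and "\<And>x. 0 \<le> x \<bullet> (A *v x)"
    and "\<And>i j. 1 \<le> i \<Longrightarrow> i \<le> j \<Longrightarrow> j \<le> CARD('n) \<Longrightarrow> lam j \<le> lam i"
    and "\<And>i. i \<in> {1..CARD('n)} \<Longrightarrow> A *v v i = lam i *\<^sub>R v i"
    and "\<And>i j. i \<in> {1..CARD('n)} \<Longrightarrow> j \<in> {1..CARD('n)} \<Longrightarrow> v i \<bullet> v j = (if i = j then 1 else 0)"
    and "\<gamma> = 2 * (lam 1 - lam CARD('n))"
    and "\<gamma> > 0"
    and "fstar = - (\<Sum>i=1..CARD('k). lam i)"
    and "represents Y (span (v ` {1..CARD('k)}))"
    and "\<And>t. represents (X t) (\<X> t)"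
    and "gr_dist (X 0) Y \<le> pi / 4"
    and "\<And>t. \<X> (Suc t) = gr_exp (X t) (- (1 / \<gamma>) *\<^sub>R gr_grad A (X t))"
  shows "(\<forall>t. gr_obj A (X t) - fstar
            \<le> (gr_obj A (X 0) - fstar + \<gamma> / 2 * (gr_dist (X 0) Y)\<^sup>2) / (0.4 * real t + 1))
       \<and> (\<lambda>t. gr_obj A (X t) - fstar) \<in> O(\<lambda>t. 1 / real t)"
proof -
  interpret ordered_eigenbasis A lam v Y
    using assms(1,2,4-6,10) by unfold_locales
  have fstar: "fstar = fmin" by (simp add: assms(9) fmin_def)
  have half_\<gamma>: "lam 1 - lam CARD('n) = \<gamma> / 2" using assms(7) by simp
  have X: "transpose (X t) ** X t = mat 1" for t
    using assms(11) by (simp add: represents_def)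
  define m where "m t = gr_obj A (X t) - fstar" for t
  define P where "P t = chordal_sq (X t) Y" for t
  \<comment> \<open>The quantity by which one step lowers the objective; it cancels when the bounds for the objective
    and for the distance are added.\<close>
  define D where "D t = (norm (gr_grad A (X t)))\<^sup>2 / (2 * \<gamma>)" for t

  have tangent: "transpose (X t) ** (- (1 / \<gamma>) *\<^sub>R gr_grad A (X t)) = 0" for t
    using gr_grad_tangent[OF X[of t], of A] by (simp only: matrix_scalar_ac scalar_matrix_assoc[symmetric]) simp
  note descent = gr_obj_exp_le[OF less_imp_le[OF assms(1)] X tangent]
  have rep: "represents (X (Suc t)) (gr_exp (X t) (- (1 / \<gamma>) *\<^sub>R gr_grad A (X t)))" for t
    using assms(11)[of "Suc t"] assms(13) by simp
  have "gr_obj A (X (Suc t)) \<le> gr_obj A (X t) - D t" for t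
    using descent[OF rep A_sym Rayleigh_bounds, of t] \<open>\<gamma> > 0\<close> half_\<gamma>
    by (simp add: D_def power2_norm_eq_inner[symmetric] field_simps power2_eq_square)
  then have m_step: "m (Suc t) \<le> m t - D t" for t by (simp add: m_def algebra_simps)
  have range: "0 * (norm z)\<^sup>2 \<le> z \<bullet> (col_proj Y *v z)" "z \<bullet> (col_proj Y *v z) \<le> 1 * (norm z)\<^sup>2" for z
    using col_proj_Pythagoras[OF Y_orth, of z] zero_le_power2[of "norm (z - col_proj Y *v z)"]
    by (simp_all add: col_proj_norm[OF Y_orth])
  have P_step: "\<gamma> / 2 * P (Suc t) \<le> \<gamma> / 2 * P t - 2 * (1 - P t) * m t + D t" for t
  proof -
    have "P (Suc t) \<le> P t - (1 / \<gamma>) * (gr_grad (col_proj Y) (X t) \<bullet> gr_grad A (X t)) + 2 / \<gamma> * D t"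
      using descent[OF rep transpose_col_proj range, of t] \<open>\<gamma> > 0\<close>
      by (simp add: P_def chordal_sq_eq_gr_obj D_def power2_eq_square)
    then have "\<gamma> / 2 * P (Suc t) \<le> \<gamma> / 2 * P t - (gr_grad (col_proj Y) (X t) \<bullet> gr_grad A (X t)) / 2 + D t"
      using \<open>\<gamma> > 0\<close> by (simp add: field_simps)
    then show ?thesis
      using grad_inner_ge[OF X[of t]] by (simp add: m_def P_def fstar algebra_simps)
  qed
  have D: "0 \<le> D t" for t using \<open>\<gamma> > 0\<close> by (simp add: D_def)
  have dist: "P 0 \<le> (gr_dist (X 0) Y)\<^sup>2"
    unfolding P_def by (rule chordal_sq_le_gr_dist_sq[OF X Y_orth])
  have "0 \<le> gr_dist (X 0) Y" by (simp add: gr_dist_def Let_def sum_nonneg)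
  \<comment> \<open>The square of \<open>\<pi> / 4\<close> is about \<open>0.617\<close>.\<close>
  then have "(gr_dist (X 0) Y)\<^sup>2 \<le> (3.1416 / 4)\<^sup>2"
    using assms(12) pi_approx by (intro power_mono) auto
  with dist have P0: "P 0 \<le> 31 / 50" by (simp add: power2_eq_square)
  have "m t * (2 / 5 * real t + 1) \<le> m 0 + \<gamma> / 2 * P 0" for t
  proof (rule potential_sequence_bound)
    show "0 \<le> m t" for t using gap_nonneg[OF X] by (simp add: m_def fstar)
    show "m t \<le> \<gamma> / 2 * P t" for t
      using gap_le_chordal[OF X[of t]] half_\<gamma> by (simp add: m_def P_def fstar)
    show "m (Suc t) \<le> m t" for t using m_step[of t] D[of t] by simp
    show "m (Suc t) + \<gamma> / 2 * P (Suc t) \<le> m t + \<gamma> / 2 * P t - 2 * (1 - P t) * m t" for t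
      using m_step[of t] P_step[of t] by simp
  qed (use P0 \<open>\<gamma> > 0\<close> in auto)
  moreover define K where "K = m 0 + \<gamma> / 2 * (gr_dist (X 0) Y)\<^sup>2"
  moreover have "\<gamma> / 2 * P 0 \<le> \<gamma> / 2 * (gr_dist (X 0) Y)\<^sup>2"
    using dist \<open>\<gamma> > 0\<close> by simp
  ultimately have K: "m t * (2 / 5 * real t + 1) \<le> K" for t by (smt (verit))
  have rate: "m t \<le> K / (0.4 * real t + 1)" for t
    using K[of t] by (simp add: pos_le_divide_eq)
  have m_nonneg: "0 \<le> m t" for t using gap_nonneg[OF X] by (simp add: m_def fstar)
  have "m \<in> O(\<lambda>t. 1 / real t)"
  proof (rule bigoI[where c = "K / 0.4"], rule eventually_mono[OF eventually_gt_at_top[of 0]])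
    fix t :: nat assume "0 < t"
    have "m t * (0.4 * real t) \<le> K"
      using K[of t] m_nonneg[of t] by (simp add: algebra_simps)
    then show "norm (m t) \<le> K / 0.4 * norm (1 / real t)"
      using \<open>0 < t\<close> m_nonneg[of t] by (simp add: field_simps)
  qed
  with rate show ?thesis unfolding m_def K_def by blast
qed

end
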